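(* Let $d, D \ge 1$ be integers and let $A \in \mathbb{R}^{d\times D}$ be a matrix with columns $a_1,\ldots,a_D \in \mathbb{R}^d$. The following are equivalent: (1) the map $\alpha_A : \widehat{\mathbb{R}^d} \to \mathbb{R}^D$ is injective (i.e. the columns of $A$ form a phase retrievable frame); (2) the map $\beta_A : \widehat{\mathbb{R}^{2\times d}} \to \mathbb{R}^{2\times D}$ is injective (i.e. $A$ is a universal key for $\mathbb{R}^{2\times d}$).
   Context: $\widehat{\mathbb{R}^d} = \mathbb{R}^d/O(1)$ is the quotient of $\mathbb{R}^d$ by the action of $O(1)=\{-1,+1\}$ by scalar multiplication, so the orbits are $[x]=\{x,-x\}$. The map $\alpha_A$ is $\alpha_A([x]) = \alpha_A(x) = (|\langle x, a_k\rangle|)_{k=1}^D$, which is well defined on the quotient. The columns of $A$ are said to form a phase retrievable frame if $\alpha_A$ is injective on $\widehat{\mathbb{R}^d}$. $\widehat{\mathbb{R}^{2\times d}} = \mathbb{R}^{2\times d}/S_2$ is the quotient of $\mathbb{R}^{2\times d}$ by the group $S_2$ of $2\times 2$ permutation matrices acting by left multiplication, so $[X]=\{PX : P \in S_2\}$. The map $\beta_A$ is $\beta_A([X]) = \beta_A(X) = \downarrow(XA)$, where $\downarrow$ sorts each column of the $2\times D$ matrix $XA$ independently in decreasing order; that is, the $k$-th column of $\beta_A(X)$ is the vector $Xa_k\in\mathbb{R}^2$ with its entries rearranged in decreasing order. This is well defined on the quotient. $A$ is called a universal key for $\mathbb{R}^{2\times d}$ if $\beta_A$ is injective on $\widehat{\mathbb{R}^{2\times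 d}}$. *)

theory Defs
  imports "HOL-Analysis.Analysis" "HOL-Combinatorics.Permutations"
begin

text \<open>A real \<open>m \<times> n\<close> matrix has type \<open>real^'n^'m\<close>. The first and second row
  of a \<open>2 \<times> n\<close> matrix have the indices \<open>1\<close> and \<open>2\<close> of the numeral type \<open>2\<close>
  (where \<open>2 = 0\<close>).\<close>

definition sign_rel :: "((real^'d) \<times> (real^'d)) set" where
  "sign_rel = {(x, y). \<exists>s\<in>{-1, 1}. y = s *\<^sub>R x}"

definition sign_quotient :: "(real^'d) set set" where
  "sign_quotient = UNIV // sign_rel"

definition alpha :: "real^'D^'d \<Rightarrow> real^'d \<Rightarrow> real^'D" where
  "alpha A x = (\<chi> k. \<bar>x \<bullet> column k A\<bar>)"

text \<open>The value of \<open>alpha\<close> common to all representatives of a class, by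
  \<open>alpha_respects\<close> below; likewise for \<open>beta_quotient\<close>.\<close>

definition alpha_quotient :: "real^'D^'d \<Rightarrow> (real^'d) set \<Rightarrow> real^'D" where
  "alpha_quotient A c = the_elem (alpha A ` c)"

definition phase_retrievable :: "real^'D^'d \<Rightarrow> bool" where
  "phase_retrievable A \<longleftrightarrow> inj_on (alpha_quotient A) sign_quotient"

definition permutation_matrices :: "(real^'n^'n) set" where
  "permutation_matrices = {(\<chi> i j. if j = p i then 1 else 0) | p. p permutes UNIV}"

definition row_perm_rel :: "((real^'d^2) \<times> (real^'d^2)) set" where
  "row_perm_rel = {(X, Y). \<exists>P\<in>permutation_matrices. Y = P ** X}"

definition row_perm_quotient :: "(real^'d^2) set set" where
  "row_perm_quotient = UNIV // row_perm_rel"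

definition sort_desc :: "real^2 \<Rightarrow> real^2" where
  "sort_desc v = vector (rev (sort [v $ 1, v $ 2]))"

definition sort_columns :: "real^'D^2 \<Rightarrow> real^'D^2" where
  "sort_columns M = (\<chi> i k. sort_desc (column k M) $ i)"

definition beta :: "real^'D^'d \<Rightarrow> real^'d^2 \<Rightarrow> real^'D^2" where
  "beta A X = sort_columns (X ** A)"

definition beta_quotient :: "real^'D^'d \<Rightarrow> (real^'d^2) set \<Rightarrow> real^'D^2" where
  "beta_quotient A c = the_elem (beta A ` c)"

definition universal_key :: "real^'D^'d \<Rightarrow> bool" where
  "universal_key A \<longleftrightarrow> inj_on (beta_quotient A) row_perm_quotient"

lemma sign_rel_Image: "sign_rel `` {x} = {x, - x}"
  by (auto simp: sign_rel_def)

lemma equiv_sign_rel: "equiv UNIV sign_rel"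
  by (rule equivI) (auto simp: sign_rel_def refl_on_def sym_def trans_def)

lemma alpha_respects: "alpha A respects sign_rel"
  by (auto simp: congruent_def sign_rel_def alpha_def)

lemma alpha_quotient_class: "alpha_quotient A (sign_rel `` {x}) = alpha A x"
proof -
  have "alpha A (- x) = alpha A x"
    by (simp add: alpha_def)
  then show ?thesis
    by (simp add: alpha_quotient_def sign_rel_Image)
qed

lemma permutes_UNIV_2: "p permutes (UNIV :: 2 set) \<longleftrightarrow> p = id \<or> p = Transposition.transpose 1 2"
proof -
  have "(UNIV :: 2 set) = {1, 2}"
    using UNIV_2 by blast
  then show ?thesis
    by (metis permutes_doubleton_iff)
qed

lemma row_perm_rel_iff:
  "(X, Y) \<in> row_perm_rel \<longleftrightarrow> Y = X \<or> (Y $ 1 = X $ 2 \<and> Y $ 2 = X $ 1)"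
proof -
  have mult: "(\<chi> i j. if j = p i then 1 else 0) ** X = (\<chi> i. X $ p i)" for p :: "2 \<Rightarrow> 2"
    by (simp add: matrix_matrix_mult_def vec_eq_iff if_distrib if_distribR cong: if_cong)
  have "(X, Y) \<in> row_perm_rel \<longleftrightarrow>
      (\<exists>p. p permutes (UNIV :: 2 set) \<and> Y = (\<chi> i. X $ p i))"
    unfolding row_perm_rel_def permutation_matrices_def using mult by auto
  also have "\<dots> \<longleftrightarrow> Y = X \<or> (Y $ 1 = X $ 2 \<and> Y $ 2 = X $ 1)"
    unfolding permutes_UNIV_2 by (auto simp: vec_eq_iff forall_2)
  finally show ?thesis .
qed

lemma equiv_row_perm_rel: "equiv UNIV row_perm_rel"
  by (rule equivI)
    (auto simp: row_perm_rel_iff refl_on_def sym_def trans_def vec_eq_iff forall_2)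

lemma sort_desc_eq: "sort_desc v = vector [max (v $ 1) (v $ 2), min (v $ 1) (v $ 2)]"
  by (auto simp: sort_desc_def)

lemma beta_respects: "beta A respects row_perm_rel"
  by (rule congruentI)
    (auto simp: row_perm_rel_iff beta_def sort_columns_def sort_desc_eq column_def
      matrix_matrix_mult_def vec_eq_iff max.commute min.commute)

lemma beta_quotient_class: "beta_quotient A (row_perm_rel `` {X}) = beta A X"
proof -
  have "beta A ` (row_perm_rel `` {X}) = {beta A X}"
    using beta_respects[of A] equiv_row_perm_rel
    by (auto simp: congruent_def equiv_def refl_on_def image_iff)
  then show ?thesis
    by (simp add: beta_quotient_def)
qed

end

theory Submission
  imports Defs
begin

text \<open>An unordered pair of real numbers \<open>{p, q}\<close> is determined by, and determines, its sum
  \<open>p + q\<close> and its absolute difference \<open>\<bar>p - q\<bar>\<close>. Applied to each column of \<open>X A\<close>, where \<open>X\<close>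
  has rows \<open>x\<^sub>1, x\<^sub>2\<close>, this shows that \<open>beta A X\<close> carries exactly the information of the linear
  measurements \<open>\<langle>x\<^sub>1 + x\<^sub>2, a\<^sub>k\<rangle>\<close> and of \<open>alpha A (x\<^sub>1 - x\<^sub>2)\<close> (lemma \<open>beta_eq_iff\<close>). Likewise the
  class of \<open>X\<close> up to exchanging rows is the vector \<open>x\<^sub>1 + x\<^sub>2\<close> together with \<open>x\<^sub>1 - x\<^sub>2\<close> up to
  sign.

  If \<open>alpha A\<close> separates vectors up to sign, then it recovers \<open>x\<^sub>1 - x\<^sub>2\<close> up to sign; moreover a
  vector \<open>w\<close> orthogonal to all columns satisfies \<open>alpha A w = alpha A 0\<close>, hence \<open>w = 0\<close>, so the
  linear measurements recover \<open>x\<^sub>1 + x\<^sub>2\<close>. Conversely, the matrices with rows \<open>x, -x\<close> have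
  vanishing row sum, and on them \<open>beta A\<close> sees only \<open>alpha A (2 x)\<close>; injectivity of \<open>beta A\<close> on
  the classes of these matrices is injectivity of \<open>alpha A\<close> on vectors up to sign.\<close>

lemma inj_on_quotient_iff:
  assumes "equiv UNIV r" and "\<And>x. g (r `` {x}) = f x"
  shows "inj_on g (UNIV // r) \<longleftrightarrow> (\<forall>x y. f x = f y \<longrightarrow> (x, y) \<in> r)"
proof -
  have "inj_on g (UNIV // r) \<longleftrightarrow> (\<forall>x y. g (r `` {x}) = g (r `` {y}) \<longrightarrow> r `` {x} = r `` {y})"
    by (auto simp: inj_on_def quotient_def)
  then show ?thesis
    using assms by (simp add: eq_equiv_class_iff)
qed

lemma phase_retrievable_iff:
  "phase_retrievable A \<longleftrightarrow> (\<forall>x y. alpha A x = alpha A y \<longrightarrow> y = x \<or> y = - x)"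
  unfolding phase_retrievable_def sign_quotient_def
    inj_on_quotient_iff[of sign_rel "alpha_quotient A" "alpha A",
      OF equiv_sign_rel alpha_quotient_class]
  by (auto simp: sign_rel_def)

lemma universal_key_iff:
  "universal_key A \<longleftrightarrow>
    (\<forall>X Y. beta A X = beta A Y \<longrightarrow> Y = X \<or> (Y $ 1 = X $ 2 \<and> Y $ 2 = X $ 1))"
  unfolding universal_key_def row_perm_quotient_def
    inj_on_quotient_iff[of row_perm_rel "beta_quotient A" "beta A",
      OF equiv_row_perm_rel beta_quotient_class] row_perm_rel_iff ..

lemma max_min_eq_iff_sum_abs_diff_eq:
  fixes p q r s :: real
  shows "max p q = max r s \<and> min p q = min r s \<longleftrightarrow> p + q = r + s \<and> \<bar>p - q\<bar> = \<bar>r - s\<bar>"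
  by (auto simp: max_def min_def abs_if split: if_splits)

lemma matrix_mult_nth_eq_inner_column:
  "(X ** A) $ i $ k = X $ i \<bullet> column k A"
  for A :: "real^'D^'d"
  by (simp add: matrix_matrix_mult_def column_def inner_vec_def)

text \<open>Separates the two measurements hidden in the sorted columns: a linear one of the row sum,
  and a phaseless one of the row difference.\<close>

lemma beta_eq_iff:
  fixes A :: "real^'D^'d"
  shows "beta A X = beta A Y \<longleftrightarrow>
    (\<forall>k. (X $ 1 + X $ 2) \<bullet> column k A = (Y $ 1 + Y $ 2) \<bullet> column k A) \<and>
    alpha A (X $ 1 - X $ 2) = alpha A (Y $ 1 - Y $ 2)"
proof -
  let ?m = "\<lambda>(Z :: real^'d^2) i k. Z $ i \<bullet> column k A"
  have "beta A X = beta A Y \<longleftrightarrow>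
      (\<forall>k. max (?m X 1 k) (?m X 2 k) = max (?m Y 1 k) (?m Y 2 k) \<and>
           min (?m X 1 k) (?m X 2 k) = min (?m Y 1 k) (?m Y 2 k))"
    by (auto simp: beta_def sort_columns_def sort_desc_eq vec_eq_iff forall_2
        column_def[of _ "_ ** _"] matrix_mult_nth_eq_inner_column)
  then show ?thesis
    unfolding max_min_eq_iff_sum_abs_diff_eq
    by (auto simp: alpha_def vec_eq_iff inner_add_left inner_diff_left)
qed

lemma rows_eq_or_swapped:
  fixes X Y :: "real^'d^2"
  assumes sum: "Y $ 1 + Y $ 2 = X $ 1 + X $ 2"
    and diff: "Y $ 1 - Y $ 2 = X $ 1 - X $ 2 \<or> Y $ 1 - Y $ 2 = - (X $ 1 - X $ 2)"
  shows "Y = X \<or> (Y $ 1 = X $ 2 \<and> Y $ 2 = X $ 1)"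
proof -
  have rows: "Z $ 1 = (1/2) *\<^sub>R ((Z $ 1 + Z $ 2) + (Z $ 1 - Z $ 2))"
    "Z $ 2 = (1/2) *\<^sub>R ((Z $ 1 + Z $ 2) - (Z $ 1 - Z $ 2))" for Z :: "real^'d^2"
    by (simp_all add: vec_eq_iff)
  from diff show ?thesis
  proof
    assume "Y $ 1 - Y $ 2 = X $ 1 - X $ 2"
    then have "Y $ 1 = X $ 1" "Y $ 2 = X $ 2"
      using rows[of X] rows[of Y] sum by metis+
    then show ?thesis
      by (simp add: vec_eq_iff[of Y X] forall_2)
  next
    assume "Y $ 1 - Y $ 2 = - (X $ 1 - X $ 2)"
    then have "Y $ 1 - Y $ 2 = X $ 2 - X $ 1"
      by simp
    then have "Y $ 1 = X $ 2" "Y $ 2 = X $ 1"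
      using sum by (simp_all add: vec_eq_iff) (smt (verit))+
    then show ?thesis
      by simp
  qed
qed

theorem theorem3:
  fixes A :: "real^'D^'d"
  shows "phase_retrievable A \<longleftrightarrow> universal_key A"
proof
  assume "phase_retrievable A"
  then have inj: "y = x \<or> y = - x" if "alpha A x = alpha A y" for x y
    using that by (simp add: phase_retrievable_iff)
  show "universal_key A"
    unfolding universal_key_iff
  proof (intro allI impI)
    fix X Y :: "real^'d^2"
    assume "beta A X = beta A Y"
    then have sum: "\<And>k. (X $ 1 + X $ 2) \<bullet> column k A = (Y $ 1 + Y $ 2) \<bullet> column k A"
      and diff: "alpha A (X $ 1 - X $ 2) = alpha A (Y $ 1 - Y $ 2)"
      by (simp_all add: beta_eq_iff)
    have "alpha A 0 = alpha A ((Y $ 1 + Y $ 2) - (X $ 1 + X $ 2))"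
      by (simp add: alpha_def inner_diff_left sum)
    then have "Y $ 1 + Y $ 2 = X $ 1 + X $ 2"
      using inj by fastforce
    then show "Y = X \<or> (Y $ 1 = X $ 2 \<and> Y $ 2 = X $ 1)"
      using inj[OF diff] by (rule rows_eq_or_swapped)
  qed
next
  assume key: "universal_key A"
  show "phase_retrievable A"
    unfolding phase_retrievable_iff
  proof (intro allI impI)
    fix x y :: "real^'d"
    assume eq: "alpha A x = alpha A y"
    let ?X = "\<lambda>z :: real^'d. vector [z, - z] :: real^'d^2"
    have double: "alpha A (z - - z) = 2 *\<^sub>R alpha A z" for z
    proof -
      have "alpha A (2 *\<^sub>R z) = 2 *\<^sub>R alpha A z"
        by (simp add: alpha_def vec_eq_iff abs_mult)
      then show ?thesis
        by (simp only: scaleR_2 diff_minus_eq_add)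
    qed
    have "beta A (?X x) = beta A (?X y)"
      unfolding beta_eq_iff vector_2 double eq by simp
    then have "?X y = ?X x \<or> (?X y $ 1 = ?X x $ 2 \<and> ?X y $ 2 = ?X x $ 1)"
      using key unfolding universal_key_iff by blast
    then show "y = x \<or> y = - x"
      by (metis vector_2(1) vector_2(2))
  qed
qed

end
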